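(* Let $s,\ell,k$ be integers with $2s+1\leq \ell$ and $\ell-s-1\leq k$. There is $n_0$ (depending on $s,\ell,k$) such that for every $n\geq n_0$ the following holds. If $\mathcal{F}\subset\binom{[n]}{k}$ is a family such that $$\binom{\ell-1}{2}-s\leq \sum_{1\leq i<j\leq \ell}|F_i\cap F_j|$$ holds for every choice of $\ell$ distinct members $F_1,\dots,F_\ell$ of $\mathcal{F}$, then $$|\mathcal{F}|\leq \binom{n-1}{k-1}+\binom{n-\ell+s+1}{k-\ell+s+2}.$$
   Context: $[n]=\{1,\dots,n\}$ and $\binom{[n]}{k}$ denotes the family of all $k$-element subsets of $[n]$. *)

theory Defs
  imports Main "HOL-Library.Ramsey"
begin

text \<open>Binomial coefficients with integer arguments, equal to \<open>0\<close> outside \<open>0 \<le> b \<le> a\<close>, so that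
  no truncated subtraction enters expressions such as \<open>k - 1\<close> at \<open>k = 0\<close>.\<close>

definition zbinom :: "int \<Rightarrow> int \<Rightarrow> int" where
  "zbinom a b = (if 0 \<le> b \<and> b \<le> a then int (nat a choose nat b) else 0)"

end

theory Submission imports Complex_Main Defs begin

text \<open>
  Put \<open>t = l - s - 1\<close>; for \<open>t \<le> 1\<close> the bound is at least \<open>n choose k\<close>. Suppose \<open>t \<ge> 2\<close>.
  If no point has large degree, \<open>l\<close> pairwise disjoint members can be chosen greedily, so the family
  must be small. If a point \<open>x\<close> has large degree, then for any two members \<open>A\<close>, \<open>B\<close> avoiding \<open>x\<close>
  there are \<open>l - 2\<close> members through \<open>x\<close> that are disjoint from \<open>A \<union> B\<close> and meet each other only
  in \<open>x\<close>. The intersection sum of these \<open>l\<close> sets is \<open>(l - 2 choose 2) + card (A \<inter> B)\<close>, whence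
  \<open>card (A \<inter> B) \<ge> t - 1\<close>. The members avoiding \<open>x\<close> thus form a \<open>(t - 1)\<close>-intersecting family on
  \<open>n - 1\<close> points, to which the Erdos-Ko-Rado theorem for large ground sets applies.
\<close>

section \<open>Counting supersets and choosing members greedily\<close>

lemma card_nsets_supset_le:
  assumes "finite X"
  shows "card {F \<in> nsets X k. S \<subseteq> F} \<le> (card X - card S) choose (k - card S)"
proof (cases "S \<subseteq> X")
  case False
  then have "{F \<in> nsets X k. S \<subseteq> F} = {}" by (auto simp: nsets_def)
  then show ?thesis by (metis card.empty le0)
next
  case True
  then have fS: "finite S" using assms finite_subset by blast
  have "card {F \<in> nsets X k. S \<subseteq> F} \<le> card (nsets (X - S) (k - card S))"
  proof (rule card_inj_on_le)
    show "inj_on (\<lambda>F. F - S) {F \<in> nsets X k. S \<subseteq> F}"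
      by (auto simp: inj_on_def)
    show "(\<lambda>F. F - S) ` {F \<in> nsets X k. S \<subseteq> F} \<subseteq> nsets (X - S) (k - card S)"
      using fS by (auto simp: nsets_def card_Diff_subset)
    show "finite (nsets (X - S) (k - card S))"
      using assms by (simp add: finite_imp_finite_nsets)
  qed
  also have "\<dots> = (card X - card S) choose (k - card S)"
    using True fS by (simp add: card_Diff_subset)
  finally show ?thesis .
qed

lemma exists_member_avoiding:
  assumes "finite \<F>" "finite A"
    and deg: "\<And>a. a \<in> A \<Longrightarrow> card {F \<in> \<F>. a \<in> F} \<le> d"
    and big: "card A * d < card \<F>"
  obtains F where "F \<in> \<F>" "F \<inter> A = {}"
proof (rule ccontr)
  assume "\<not> thesis"
  then have "\<F> \<subseteq> (\<Union>a\<in>A. {F \<in> \<F>. a \<in> F})" using that by blast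
  then have "card \<F> \<le> card (\<Union>a\<in>A. {F \<in> \<F>. a \<in> F})"
    using assms by (intro card_mono) auto
  also have "\<dots> \<le> (\<Sum>a\<in>A. card {F \<in> \<F>. a \<in> F})"
    using \<open>finite A\<close> by (rule card_UN_le)
  also have "\<dots> \<le> card A * d"
    using sum_bounded_above[of A "\<lambda>a. card {F \<in> \<F>. a \<in> F}" d] deg by simp
  finally show False using big by simp
qed

text \<open>A member that contains \<open>S\<close> and meets \<open>A\<close> in \<open>a\<close>
  contains \<open>insert a S\<close>, so counting supersets bounds the degree of \<open>a\<close>; a
  union bound over \<open>A\<close> then leaves a member free of \<open>A\<close>.\<close>

lemma exists_supset_member_avoiding:
  assumes "finite X" "\<F> \<subseteq> nsets X k" "finite S" "finite A" "S \<inter> A = {}"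
    and big: "card A * ((card X - card S - 1) choose (k - card S - 1)) < card {F \<in> \<F>. S \<subseteq> F}"
  obtains F where "F \<in> \<F>" "S \<subseteq> F" "F \<inter> A = {}"
proof -
  have fin: "finite \<F>" using assms finite_imp_finite_nsets finite_subset by blast
  have "card {F \<in> {F \<in> \<F>. S \<subseteq> F}. a \<in> F} \<le> (card X - card S - 1) choose (k - card S - 1)"
    if "a \<in> A" for a
  proof -
    have "a \<notin> S" using that \<open>S \<inter> A = {}\<close> by blast
    then have c: "card (insert a S) = card S + 1" using \<open>finite S\<close> by simp
    have "card {F \<in> {F \<in> \<F>. S \<subseteq> F}. a \<in> F} \<le> card {F \<in> nsets X k. insert a S \<subseteq> F}"
      using assms by (intro card_mono) (auto simp: finite_imp_finite_nsets)
    also have "\<dots> \<le> (card X - card S - 1) choose (k - card S - 1)"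
      using card_nsets_supset_le[OF \<open>finite X\<close>, of k "insert a S"] unfolding c by simp
    finally show ?thesis .
  qed
  then obtain F where "F \<in> {F \<in> \<F>. S \<subseteq> F}" "F \<inter> A = {}"
    using exists_member_avoiding[OF _ \<open>finite A\<close> _ big] fin by auto
  then show thesis using that by blast
qed

text \<open>\<open>S\<close> is the kernel of a sunflower that also misses \<open>B\<close>. The
  sets are chosen one at a time: each new one has to avoid \<open>B\<close> and the earlier petals,
  at most \<open>card B + m * k\<close> points, which the budget \<open>N\<close> covers. Needed for
  \<open>S = {x}\<close> and for \<open>S = {}\<close>.\<close>

lemma greedy_sunflower:
  assumes card: "\<And>F. F \<in> \<F> \<Longrightarrow> finite F \<and> card F = k"
    and avoid: "\<And>A. \<lbrakk>finite A; S \<inter> A = {}; card A \<le> N\<rbrakk> \<Longrightarrow> \<exists>F\<in>\<F>. S \<subseteq> F \<and> F \<inter> A = {}"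
    and B: "finite B" "S \<inter> B = {}"
    and "card B + m * k \<le> N"
  shows "\<exists>f :: nat \<Rightarrow> 'a set. (\<forall>i\<in>{1..m}. f i \<in> \<F> \<and> S \<subseteq> f i \<and> f i \<inter> B = {}) \<and>
           (\<forall>i\<in>{1..m}. \<forall>j\<in>{1..m}. i \<noteq> j \<longrightarrow> f i \<inter> f j = S)"
  using \<open>card B + m * k \<le> N\<close>
proof (induction m)
  case 0
  show ?case by simp
next
  case (Suc m)
  then obtain f where f: "\<forall>i\<in>{1..m}. f i \<in> \<F> \<and> S \<subseteq> f i \<and> f i \<inter> B = {}"
      "\<forall>i\<in>{1..m}. \<forall>j\<in>{1..m}. i \<noteq> j \<longrightarrow> f i \<inter> f j = S"
    by auto
  let ?U = "\<Union>i\<in>{1..m}. f i - S"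
  have "card ?U \<le> (\<Sum>i\<in>{1..m}. card (f i - S))" by (rule card_UN_le) simp
  also have "\<dots> \<le> (\<Sum>i\<in>{1..m}. k)"
    using f card by (intro sum_mono) (metis Diff_subset card_mono)
  finally have "card ?U \<le> m * k" by simp
  then have "card (B \<union> ?U) \<le> N"
    using card_Un_le[of B ?U] Suc.prems by simp
  moreover have "finite (B \<union> ?U)" using B f card by auto
  ultimately obtain G where G: "G \<in> \<F>" "S \<subseteq> G" "G \<inter> (B \<union> ?U) = {}"
    using avoid[of "B \<union> ?U"] B by blast
  \<comment> \<open>\<open>G\<close> contains \<open>S\<close> and avoids the petal
    \<open>f i - S\<close>.\<close>
  have fG: "f i \<inter> G = S" if "i \<in> {1..m}" for i
    using that f G by blast
  have "(\<forall>i\<in>{1..Suc m}. (f(Suc m := G)) i \<in> \<F> \<and> S \<subseteq> (f(Suc m := G)) i \<and> (f(Suc m := G)) i \<inter> B = {})"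
    using f G by (auto simp: atLeastAtMostSuc_conv)
  moreover have "(\<forall>i\<in>{1..Suc m}. \<forall>j\<in>{1..Suc m}. i \<noteq> j \<longrightarrow>
      (f(Suc m := G)) i \<inter> (f(Suc m := G)) j = S)"
    using f fG by (simp add: atLeastAtMostSuc_conv Int_commute)
  ultimately show ?case by blast
qed

section \<open>The Erdos-Ko-Rado theorem for large ground sets\<close>

text \<open>The ratio of the two binomials is \<open>a / b\<close>, which is at least
  \<open>c\<close>. This absorbs constant factors once the ground set is large.\<close>

lemma const_mult_binomial_le:
  assumes "1 \<le> b" "b \<le> a" "b * c \<le> a"
  shows "c * ((a - 1) choose (b - 1)) \<le> a choose b"
proof -
  have "b * (c * ((a - 1) choose (b - 1))) \<le> a * ((a - 1) choose (b - 1))"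
    using mult_right_mono[OF assms(3), of "(a - 1) choose (b - 1)"] by (simp add: mult.assoc)
  also have "\<dots> = b * (a choose b)"
    using assms times_binomial_minus1_eq[of b a] by simp
  finally show ?thesis using assms by simp
qed

text \<open>Either some \<open>r\<close>-set \<open>R\<close> lies in so many members that no member
  can miss a point of \<open>R\<close>, and supersets of \<open>R\<close> are counted; or every
  \<open>r\<close>-set lies in few members, and since each member contains an
  \<open>r\<close>-subset of one fixed member \<open>A\<close>, the family has lower order.\<close>

theorem Erdos_Ko_Rado_large:
  assumes X: "finite X" and \<F>: "\<F> \<subseteq> nsets X k" and "r < k"
    and large: "k + k * (k * (k choose r)) \<le> card X"
    and int: "\<And>A B. \<lbrakk>A \<in> \<F>; B \<in> \<F>; A \<noteq> B\<rbrakk> \<Longrightarrow> r \<le> card (A \<inter> B)"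
  shows "card \<F> \<le> (card X - r) choose (k - r)"
proof (cases "\<F> = {}")
  case True
  then show ?thesis by simp
next
  case False
  then obtain A where A: "A \<in> \<F>" by blast
  have mem: "finite F" "card F = k" if "F \<in> \<F>" for F
    using that \<F> by (auto simp: nsets_def)
  have fin: "finite \<F>" using X \<F> finite_imp_finite_nsets finite_subset by blast
  \<comment> \<open>At most \<open>d\<close> members contain a given \<open>r\<close>-set and also
    meet a given set of at most \<open>k\<close> points disjoint from it.\<close>
  define d where "d = k * ((card X - r - 1) choose (k - r - 1))"
  show ?thesis
  proof (cases "\<exists>R. finite R \<and> card R = r \<and> d < card {F \<in> \<F>. R \<subseteq> F}")
    case True
    then obtain R where R: "finite R" "card R = r" "d < card {F \<in> \<F>. R \<subseteq> F}" by blast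
    have "R \<subseteq> G" if G: "G \<in> \<F>" for G
    proof (rule ccontr)
      assume nR: "\<not> R \<subseteq> G"
      have "card (G - R) \<le> k" using mem[OF G] by (metis Diff_subset card_mono)
      then have "card (G - R) * ((card X - card R - 1) choose (k - card R - 1)) \<le> d"
        unfolding d_def R(2) by (rule mult_right_mono) simp
      then have "card (G - R) * ((card X - card R - 1) choose (k - card R - 1)) < card {F \<in> \<F>. R \<subseteq> F}"
        using R(3) by linarith
      then obtain F where F: "F \<in> \<F>" "R \<subseteq> F" "F \<inter> (G - R) = {}"
        using exists_supset_member_avoiding[OF X \<F> R(1), of "G - R"] mem[OF G] by blast
      \<comment> \<open>\<open>F\<close> meets \<open>G\<close> only inside \<open>R\<close>, and
        \<open>G\<close> misses a point of \<open>R\<close>, so the intersection is too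
        small.\<close>
      then have "F \<inter> G \<subset> R" using nR by blast
      then have "card (F \<inter> G) < r" using R psubset_card_mono by blast
      moreover have "F \<noteq> G" using F nR by blast
      ultimately show False using int[OF F(1) G] by simp
    qed
    then have "card \<F> \<le> card {F \<in> nsets X k. R \<subseteq> F}"
      using X \<F> by (intro card_mono) (auto simp: finite_imp_finite_nsets)
    then show ?thesis using card_nsets_supset_le[OF X, of k R] R by simp
  next
    case small: False
    have "\<F> \<subseteq> (\<Union>R\<in>nsets A r. {F \<in> \<F>. R \<subseteq> F})"
    proof
      fix F assume F: "F \<in> \<F>"
      \<comment> \<open>\<open>int\<close> concerns distinct members only; for \<open>A = F\<close>
        the intersection has \<open>k > r\<close> points.\<close>
      have "r \<le> card (A \<inter> F)"
        using int[OF A F] mem[OF A] \<open>r < k\<close> by (cases "A = F") auto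
      then obtain R where "R \<subseteq> A \<inter> F" "card R = r" "finite R"
        by (rule obtain_subset_with_card_n)
      then have "R \<in> nsets A r" "R \<subseteq> F" by (auto simp: nsets_def)
      with F show "F \<in> (\<Union>R\<in>nsets A r. {F \<in> \<F>. R \<subseteq> F})" by blast
    qed
    then have "card \<F> \<le> card (\<Union>R\<in>nsets A r. {F \<in> \<F>. R \<subseteq> F})"
      using fin mem[OF A] by (intro card_mono) (auto simp: finite_imp_finite_nsets)
    also have "\<dots> \<le> (\<Sum>R\<in>nsets A r. card {F \<in> \<F>. R \<subseteq> F})"
      using mem[OF A] by (intro card_UN_le) (simp add: finite_imp_finite_nsets)
    also have "\<dots> \<le> (\<Sum>R\<in>nsets A r. d)"
      using small by (intro sum_mono) (auto simp: nsets_def not_less)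
    also have "\<dots> = (k * (k choose r)) * ((card X - r - 1) choose (k - r - 1))"
      using mem[OF A] by (simp add: d_def)
    also have "\<dots> \<le> (card X - r) choose (k - r)"
    proof (rule const_mult_binomial_le)
      have "(k - r) * (k * (k choose r)) \<le> k * (k * (k choose r))"
        by (rule mult_right_mono) auto
      then show "(k - r) * (k * (k choose r)) \<le> card X - r" using large \<open>r < k\<close> by linarith
      show "k - r \<le> card X - r" "1 \<le> k - r" using large \<open>r < k\<close> by auto
    qed
    finally show ?thesis .
  qed
qed

section \<open>Sums over pairs of indices\<close>

abbreviation pair_sum :: "(nat \<Rightarrow> nat \<Rightarrow> int) \<Rightarrow> nat \<Rightarrow> int" where
  "pair_sum g l \<equiv> (\<Sum>(i, j) \<in> {(i, j). 1 \<le> i \<and> i < j \<and> j \<le> l}. g i j)"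

text \<open>Separates the pairs whose larger index is \<open>Suc m\<close>; applied twice, it
  detaches two sets placed last from the sunflower before them.\<close>

lemma pair_sum_Suc: "pair_sum g (Suc m) = pair_sum g m + (\<Sum>i\<in>{1..m}. g i (Suc m))"
proof -
  let ?P = "{(i, j). 1 \<le> i \<and> i < j \<and> j \<le> m}" and ?Q = "(\<lambda>i. (i, Suc m)) ` {1..m}"
  have "{(i, j). 1 \<le> i \<and> i < j \<and> j \<le> Suc m} = ?P \<union> ?Q" by auto
  moreover have "finite ?P" by (rule finite_subset[of _ "{1..m} \<times> {1..m}"]) auto
  ultimately have "pair_sum g (Suc m) = pair_sum g m + (\<Sum>(i, j)\<in>?Q. g i j)"
    by (auto intro: sum.union_disjoint)
  also have "(\<Sum>(i, j)\<in>?Q. g i j) = (\<Sum>i\<in>{1..m}. g i (Suc m))"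
    by (subst sum.reindex) (auto simp: inj_on_def)
  finally show ?thesis .
qed

lemma pair_sum_const:
  assumes "\<And>i j. \<lbrakk>1 \<le> i; i < j; j \<le> m\<rbrakk> \<Longrightarrow> g i j = c"
  shows "pair_sum g m = c * int (m choose 2)"
  using assms
proof (induction m)
  case 0
  have "{(i, j). 1 \<le> i \<and> i < j \<and> j \<le> (0::nat)} = {}" by auto
  then show ?case by (simp only: sum.empty) simp
next
  case (Suc m)
  have "pair_sum g (Suc m) = c * int (m choose 2) + (\<Sum>i\<in>{1..m}. c)"
    unfolding pair_sum_Suc using Suc by (auto intro!: sum.cong arg_cong2[of _ _ _ _ "(+)"])
  also have "\<dots> = c * int (Suc m choose 2)"
    by (simp add: numeral_2_eq_2 algebra_simps)
  finally show ?case .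
qed

lemma zbinom_int: "zbinom (int a) (int b) = int (a choose b)"
  by (auto simp: zbinom_def binomial_eq_0)

section \<open>Heavy points and their absence\<close>

text \<open>Here \<open>m\<close> plays the role of \<open>l - 2\<close>. In \<open>heavy\<close>,
  the factor \<open>k * (m + 2)\<close> pays for avoiding \<open>A\<close>, \<open>B\<close> and
  \<open>m\<close> further sets of size \<open>k\<close>; the binomial bounds the members through
  \<open>x\<close> and one other point.\<close>

lemma intersecting_off_heavy_point:
  fixes \<F> :: "nat set set"
  assumes X: "finite X" and \<F>: "\<F> \<subseteq> nsets X k" and "2 \<le> k"
    and hyp: "\<And>F :: nat \<Rightarrow> nat set. \<lbrakk>F ` {1..m + 2} \<subseteq> \<F>; inj_on F {1..m + 2}\<rbrakk> \<Longrightarrow>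
           int (m choose 2) + q \<le> pair_sum (\<lambda>i j. int (card (F i \<inter> F j))) (m + 2)"
    and heavy: "k * (m + 2) * ((card X - 2) choose (k - 2)) < card {F \<in> \<F>. x \<in> F}"
    and AB: "A \<in> \<F>" "B \<in> \<F>" "A \<noteq> B" "x \<notin> A" "x \<notin> B"
  shows "q \<le> int (card (A \<inter> B))"
proof -
  have mem: "finite F \<and> card F = k" if "F \<in> \<F>" for F
    using that \<F> by (auto simp: nsets_def)
  have avoid: "\<exists>F\<in>\<F>. {x} \<subseteq> F \<and> F \<inter> C = {}"
    if C: "finite C" "{x} \<inter> C = {}" "card C \<le> k * (m + 2)" for C
  proof -
    have "card C * ((card X - 2) choose (k - 2)) \<le> k * (m + 2) * ((card X - 2) choose (k - 2))"
      by (rule mult_right_mono[OF C(3)]) simp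
    then have "card C * ((card X - 2) choose (k - 2)) < card {F \<in> \<F>. x \<in> F}"
      using heavy by linarith
    then have "card C * ((card X - card {x} - 1) choose (k - card {x} - 1)) < card {F \<in> \<F>. {x} \<subseteq> F}"
      by (simp add: numeral_2_eq_2)
    from exists_supset_member_avoiding[OF X \<F> _ C(1,2) this]
    show ?thesis by auto
  qed
  have "finite (A \<union> B)" "{x} \<inter> (A \<union> B) = {}" using mem AB by auto
  moreover have "card (A \<union> B) + m * k \<le> k * (m + 2)"
    using card_Un_le[of A B] mem AB by (simp add: algebra_simps)
  ultimately have "\<exists>f :: nat \<Rightarrow> nat set.
      (\<forall>i\<in>{1..m}. f i \<in> \<F> \<and> {x} \<subseteq> f i \<and> f i \<inter> (A \<union> B) = {}) \<and>
      (\<forall>i\<in>{1..m}. \<forall>j\<in>{1..m}. i \<noteq> j \<longrightarrow> f i \<inter> f j = {x})"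
    by - (rule greedy_sunflower[OF mem avoid])
  then obtain f :: "nat \<Rightarrow> nat set"
    where f: "\<forall>i\<in>{1..m}. f i \<in> \<F> \<and> {x} \<subseteq> f i \<and> f i \<inter> (A \<union> B) = {}"
      and ff: "\<forall>i\<in>{1..m}. \<forall>j\<in>{1..m}. i \<noteq> j \<longrightarrow> f i \<inter> f j = {x}"
    by (elim exE conjE)
  \<comment> \<open>\<open>A\<close> and \<open>B\<close> take the last two indices, where
    \<open>pair_sum_Suc\<close> can split them off.\<close>
  define F where "F = f(Suc m := A, Suc (Suc m) := B)"
  have F: "F i = f i" if "i \<le> m" for i using that by (simp add: F_def)
  have FA: "F (Suc m) = A" and FB: "F (Suc (Suc m)) = B" by (simp_all add: F_def)
  \<comment> \<open>Two equal sets would coincide with the kernel \<open>{x}\<close>, too small for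
    a member since \<open>2 \<le> k\<close>.\<close>
  have inj_f: "inj_on f {1..m}"
  proof (rule inj_onI, rule ccontr)
    fix i j assume "i \<in> {1..m}" "j \<in> {1..m}" "f i = f j" "i \<noteq> j"
    then have "f i = {x}" "f i \<in> \<F>" using f ff by (metis Int_absorb, blast)
    then show False using mem[of "f i"] \<open>2 \<le> k\<close> by simp
  qed
  have ivl: "{1..m + 2} = insert (Suc (Suc m)) (insert (Suc m) {1..m})" by auto
  have img: "F ` {1..m} = f ` {1..m}" using F by (intro image_cong) auto
  have "inj_on F {1..m} \<longleftrightarrow> inj_on f {1..m}" using F by (intro inj_on_cong) auto
  then have inj_F: "inj_on F {1..m}" using inj_f by blast
  have "C \<notin> f ` {1..m}" if "x \<notin> C" for C using f that by blast
  then have "A \<notin> F ` {1..m}" "B \<notin> F ` {1..m}" using AB unfolding img by blast+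
  moreover have "{1..m} - {Suc m} = {1..m}" "insert (Suc m) {1..m} - {Suc (Suc m)} = insert (Suc m) {1..m}"
    by auto
  ultimately have inj: "inj_on F {1..m + 2}"
    unfolding ivl using inj_F AB(3) by (simp only: inj_on_insert image_insert FA FB) blast
  have "f ` {1..m} \<subseteq> \<F>" using f by blast
  then have "F ` {1..m + 2} \<subseteq> \<F>"
    unfolding ivl image_insert FA FB img using AB by blast
  from hyp[OF this inj]
  have "int (m choose 2) + q \<le> pair_sum (\<lambda>i j. int (card (F i \<inter> F j))) (Suc (Suc m))" by simp
  also have "\<dots> = pair_sum (\<lambda>i j. int (card (F i \<inter> F j))) m
      + (\<Sum>i\<in>{1..m}. int (card (F i \<inter> A)))
      + (\<Sum>i\<in>{1..m}. int (card (F i \<inter> B))) + int (card (A \<inter> B))"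
    unfolding pair_sum_Suc FA FB by (simp add: FA FB)
  also have "(\<Sum>i\<in>{1..m}. int (card (F i \<inter> A))) = 0"
  proof (intro sum.neutral ballI)
    fix i assume "i \<in> {1..m}"
    then have "F i \<inter> A = {}" using f F[of i] by fastforce
    then show "int (card (F i \<inter> A)) = 0" by simp
  qed
  also have "(\<Sum>i\<in>{1..m}. int (card (F i \<inter> B))) = 0"
  proof (intro sum.neutral ballI)
    fix i assume "i \<in> {1..m}"
    then have "F i \<inter> B = {}" using f F[of i] by fastforce
    then show "int (card (F i \<inter> B)) = 0" by simp
  qed
  also have "pair_sum (\<lambda>i j. int (card (F i \<inter> F j))) m = 1 * int (m choose 2)"
    by (rule pair_sum_const) (use ff F in simp)
  finally show ?thesis by simp
qed

text \<open>In a larger family the greedy choice with empty kernel yields \<open>l\<close> pairwise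
  disjoint members, whose pair sum is 0.\<close>

lemma card_le_if_no_heavy_point:
  fixes \<F> :: "nat set set"
  assumes "finite \<F>" and mem: "\<And>F. F \<in> \<F> \<Longrightarrow> finite F \<and> card F = k" and "0 < k"
    and hyp: "\<And>F :: nat \<Rightarrow> nat set. \<lbrakk>F ` {1..l} \<subseteq> \<F>; inj_on F {1..l}\<rbrakk> \<Longrightarrow>
           0 < pair_sum (\<lambda>i j. int (card (F i \<inter> F j))) l"
    and light: "\<And>x. card {F \<in> \<F>. x \<in> F} \<le> d"
  shows "card \<F> \<le> k * l * d"
proof (rule ccontr)
  assume big: "\<not> card \<F> \<le> k * l * d"
  have "\<exists>F\<in>\<F>. {} \<subseteq> F \<and> F \<inter> C = {}" if C: "finite C" "card C \<le> k * l" for C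
  proof -
    have "card C * d \<le> k * l * d" by (rule mult_right_mono[OF C(2)]) simp
    then have "card C * d < card \<F>" using big by linarith
    then show ?thesis
      using exists_member_avoiding[of \<F> C d] assms(1) C light by blast
  qed
  then obtain f :: "nat \<Rightarrow> nat set" where f: "\<forall>i\<in>{1..l}. f i \<in> \<F>"
      and ff: "\<forall>i\<in>{1..l}. \<forall>j\<in>{1..l}. i \<noteq> j \<longrightarrow> f i \<inter> f j = {}"
    using greedy_sunflower[of \<F> k "{}" "k * l" "{}" l] mem by (auto simp: mult.commute)
  have "inj_on f {1..l}"
  proof (rule inj_onI, rule ccontr)
    fix i j assume "i \<in> {1..l}" "j \<in> {1..l}" "f i = f j" "i \<noteq> j"
    then have "f i = {}" "f i \<in> \<F>" using f ff by (metis Int_absorb, blast)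
    then show False using mem[of "f i"] \<open>0 < k\<close> by simp
  qed
  then have "0 < pair_sum (\<lambda>i j. int (card (f i \<inter> f j))) l" using hyp f by blast
  also have "\<dots> = 0 * int (l choose 2)"
    by (rule pair_sum_const) (use ff in simp)
  finally show False by simp
qed

text \<open>With a heavy point, its star accounts for the first binomial and the members off it, an
  \<open>r\<close>-intersecting family on \<open>n - 1\<close> points, for the second. Without one,
  the whole family fits into the first binomial.\<close>

lemma card_le_if_pair_sum_ge:
  fixes \<F> :: "nat set set"
  assumes \<F>: "\<F> \<subseteq> nsets {1..n} k" and r: "1 \<le> r" "r < k"
    and hyp: "\<And>F :: nat \<Rightarrow> nat set. \<lbrakk>F ` {1..m + 2} \<subseteq> \<F>; inj_on F {1..m + 2}\<rbrakk> \<Longrightarrow>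
           int (m choose 2) + int r \<le> pair_sum (\<lambda>i j. int (card (F i \<inter> F j))) (m + 2)"
    and large: "1 + k + k * (k * (m + 2))^2 + k * (k * (k choose r)) \<le> n"
  shows "card \<F> \<le> ((n - 1) choose (k - 1)) + ((n - 1 - r) choose (k - r))"
proof -
  have mem: "finite F \<and> card F = k" if "F \<in> \<F>" for F
    using that \<F> by (auto simp: nsets_def)
  have fin: "finite \<F>" using \<F> finite_imp_finite_nsets finite_subset by blast
  define d where "d = k * (m + 2) * ((n - 2) choose (k - 2))"
  show ?thesis
  proof (cases "\<exists>x. d < card {F \<in> \<F>. x \<in> F}")
    case True
    then obtain x where x: "d < card {F \<in> \<F>. x \<in> F}" by blast
    then have "{F \<in> \<F>. x \<in> F} \<noteq> {}" by force
    then have xn: "x \<in> {1..n}" using \<F> unfolding nsets_def by blast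
    let ?G = "{F \<in> \<F>. x \<notin> F}"
    have "card \<F> = card ({F \<in> \<F>. x \<in> F} \<union> ?G)" by (rule arg_cong[of _ _ card]) auto
    also have "\<dots> \<le> card {F \<in> \<F>. x \<in> F} + card ?G" by (rule card_Un_le)
    finally have split: "card \<F> \<le> card {F \<in> \<F>. x \<in> F} + card ?G" .
    have "card {F \<in> \<F>. x \<in> F} \<le> card {F \<in> nsets {1..n} k. {x} \<subseteq> F}"
      using \<F> by (intro card_mono) (auto simp: finite_imp_finite_nsets)
    also have "\<dots> \<le> (n - 1) choose (k - 1)"
      using card_nsets_supset_le[of "{1..n}" k "{x}"] by simp
    finally have star: "card {F \<in> \<F>. x \<in> F} \<le> (n - 1) choose (k - 1)" .
    have c: "card ({1..n} - {x}) = n - 1" using xn by simp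
    have "card ?G \<le> (card ({1..n} - {x}) - r) choose (k - r)"
    proof (rule Erdos_Ko_Rado_large)
      show "?G \<subseteq> nsets ({1..n} - {x}) k" using \<F> by (auto simp: nsets_def)
      show "k + k * (k * (k choose r)) \<le> card ({1..n} - {x})" unfolding c using large by simp
      show "r \<le> card (A \<inter> B)" if "A \<in> ?G" "B \<in> ?G" "A \<noteq> B" for A B
      proof -
        have "int r \<le> int (card (A \<inter> B))"
          by (rule intersecting_off_heavy_point[of "{1..n}" \<F> k m "int r" x A B])
            (use \<F> r hyp x that in \<open>auto simp: d_def\<close>)
        then show ?thesis by simp
      qed
    qed (use r in auto)
    then show ?thesis using split star unfolding c by linarith
  next
    case False
    have "card \<F> \<le> k * (m + 2) * d"
    proof (rule card_le_if_no_heavy_point)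
      show "0 < pair_sum (\<lambda>i j. int (card (F i \<inter> F j))) (m + 2)"
        if "F ` {1..m + 2} \<subseteq> \<F>" "inj_on F {1..m + 2}" for F
        using hyp[OF that] r by linarith
    qed (use fin mem r False in \<open>auto simp: not_less\<close>)
    \<comment> \<open>The greedy bound is a constant times \<open>(n - 2) choose (k - 2)\<close>,
      and \<open>large\<close> makes \<open>n - 1\<close> big enough to absorb that
      constant.\<close>
    also have "\<dots> = (k * (m + 2))^2 * ((n - 1 - 1) choose (k - 1 - 1))"
      by (simp add: d_def power2_eq_square numeral_2_eq_2)
    also have "\<dots> \<le> (n - 1) choose (k - 1)"
    proof (rule const_mult_binomial_le)
      have "(k - 1) * (k * (m + 2))^2 \<le> k * (k * (m + 2))^2" by (rule mult_right_mono) auto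
      then show "(k - 1) * (k * (m + 2))^2 \<le> n - 1" using large by linarith
      show "1 \<le> k - 1" "k - 1 \<le> n - 1" using r large by linarith+
    qed
    finally show ?thesis by simp
  qed
qed

section \<open>Small \<open>t\<close> and the final assembly\<close>

text \<open>For \<open>t = 0\<close> the second term is \<open>n choose (k + 1)\<close>, and the
  binomials still increase there because \<open>2 * k + 2 \<le> n\<close>; for \<open>t = 1\<close>
  Pascal's rule gives equality.\<close>

lemma binomial_le_zbinom_add:
  assumes "t \<le> 1" "t \<le> k" "2 * k + 2 \<le> n"
  shows "int (n choose k) \<le> zbinom (int n - 1) (int k - 1) + zbinom (int n - int t) (int k - int t + 1)"
proof (cases "t = 0")
  case True
  have "zbinom (int n) (int k + 1) = int (n choose (k + 1))"
    using zbinom_int[of n "k + 1"] by (simp add: add.commute)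
  moreover have "n choose k \<le> n choose (k + 1)" by (rule binomial_mono) (use assms in auto)
  moreover have "0 \<le> zbinom (int n - 1) (int k - 1)" by (simp add: zbinom_def)
  ultimately show ?thesis using True by simp
next
  case False
  then have t: "t = 1" using assms by simp
  obtain k' n' where "k = Suc k'" "n = Suc n'"
    using assms t by (metis Suc_le_D One_nat_def add_2_eq_Suc')
  then show ?thesis using zbinom_int[of n' k'] zbinom_int[of n' "Suc k'"] t by (simp add: add.commute)
qed

theorem theorem8:
  fixes s :: int and l k :: nat
  assumes "2 * s + 1 \<le> int l"
    and "int l - s - 1 \<le> int k"
  shows "\<exists>n0::nat. \<forall>n\<ge>n0. \<forall>\<F> :: nat set set.
           \<F> \<subseteq> nsets {1..n} k \<longrightarrow>
           (\<forall>F :: nat \<Rightarrow> nat set. F ` {1..l} \<subseteq> \<F> \<and> inj_on F {1..l} \<longrightarrow>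
              zbinom (int l - 1) 2 - s
                \<le> (\<Sum>(i, j) \<in> {(i, j). 1 \<le> i \<and> i < j \<and> j \<le> l}. int (card (F i \<inter> F j)))) \<longrightarrow>
           int (card \<F>)
             \<le> zbinom (int n - 1) (int k - 1)
               + zbinom (int n - int l + s + 1) (int k - int l + s + 2)"
proof -
  \<comment> \<open>\<open>nat\<close> truncates nothing: \<open>l - s - 1\<close> is at least
    \<open>s\<close> by the first assumption, and at least \<open>l\<close> if
    \<open>s < 0\<close>.\<close>
  define t where "t = nat (int l - s - 1)"
  have t: "int t = int l - s - 1" using assms by (simp add: t_def)
  then have "t \<le> k" using assms by simp
  \<comment> \<open>The summands serve, in order, the case \<open>t \<le> 1\<close> and basic size
    conditions, the case without a heavy point, and the Erdos-Ko-Rado bound with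
    \<open>r = t - 1\<close>.\<close>
  define n0 where "n0 = 2 * k + 2 + k * (k * l)^2 + k * (k * (k choose (t - 1)))"
  have "int (card \<F>) \<le> zbinom (int n - 1) (int k - 1) + zbinom (int n - int t) (int k - int t + 1)"
    if n: "n0 \<le> n" and \<F>: "\<F> \<subseteq> nsets {1..n} k"
      and hyp: "\<forall>F :: nat \<Rightarrow> nat set. F ` {1..l} \<subseteq> \<F> \<and> inj_on F {1..l} \<longrightarrow>
        zbinom (int l - 1) 2 - s \<le> pair_sum (\<lambda>i j. int (card (F i \<inter> F j))) l" for n \<F>
  proof (cases "t \<le> 1")
    case True
    have "card \<F> \<le> card (nsets {1..n} k)" using \<F> finite_imp_finite_nsets by (intro card_mono) auto
    then have "int (card \<F>) \<le> int (n choose k)" by simp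
    also have "\<dots> \<le> zbinom (int n - 1) (int k - 1) + zbinom (int n - int t) (int k - int t + 1)"
      using True \<open>t \<le> k\<close> n by (intro binomial_le_zbinom_add) (auto simp: n0_def)
    finally show ?thesis .
  next
    case t2: False
    show ?thesis
    proof (cases "l \<le> 1")
      case True
      \<comment> \<open>Here \<open>t \<ge> 2\<close> forces \<open>s < 0\<close>, so the required
        lower bound is positive while the sum has no pairs. A constant choice is injective on at
        most one index, so any member would violate the hypothesis.\<close>
      have "\<F> = {}"
      proof (rule ccontr)
        assume "\<F> \<noteq> {}"
        then obtain A where "A \<in> \<F>" by blast
        then have "(\<lambda>_. A) ` {1..l} \<subseteq> \<F>" "inj_on (\<lambda>_. A) {1..l}"
          using True by (auto simp: inj_on_def)
        then have "zbinom (int l - 1) 2 - s \<le> pair_sum (\<lambda>i j. int (card (A \<inter> A))) l"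
          using hyp by fast
        also have "{(i, j). 1 \<le> i \<and> i < j \<and> j \<le> l} = {}" using True by auto
        finally have "zbinom (int l - 1) 2 \<le> s" by simp
        moreover have "0 \<le> zbinom (int l - 1) 2" by (simp add: zbinom_def)
        ultimately show False using t t2 True by linarith
      qed
      then show ?thesis by (simp add: zbinom_def)
    next
      case False
      define m r where "m = l - 2" and "r = t - 1"
      have l: "l = m + 2" using False by (simp add: m_def)
      have tr: "t = r + 1" "1 \<le> r" "r < k" using t2 \<open>t \<le> k\<close> by (auto simp: r_def)
      \<comment> \<open>Pascal's rule splits \<open>Suc m choose 2\<close> into \<open>m\<close>
        plus \<open>m choose 2\<close>, and \<open>m - s = t - 1 = r\<close>.\<close>
      have "zbinom (int l - 1) 2 = int (Suc m choose 2)"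
        using zbinom_int[of "Suc m" 2] by (simp add: l add.commute)
      then have z: "zbinom (int l - 1) 2 - s = int (m choose 2) + int r"
        using t tr l by (simp add: numeral_2_eq_2)
      have "card \<F> \<le> ((n - 1) choose (k - 1)) + ((n - 1 - r) choose (k - r))"
      proof (rule card_le_if_pair_sum_ge[OF \<F> tr(2,3)])
        show "int (m choose 2) + int r \<le> pair_sum (\<lambda>i j. int (card (F i \<inter> F j))) (m + 2)"
          if "F ` {1..m + 2} \<subseteq> \<F>" "inj_on F {1..m + 2}" for F
          using hyp[rule_format, of F] that unfolding z by (simp add: l)
        show "1 + k + k * (k * (m + 2))^2 + k * (k * (k choose r)) \<le> n"
          using n unfolding n0_def r_def[symmetric] l by linarith
      qed
      moreover have "2 * k + 2 \<le> n" using n by (simp add: n0_def)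
      then have "int n - 1 = int (n - 1)" "int k - 1 = int (k - 1)"
        "int n - int t = int (n - 1 - r)" "int k - int t + 1 = int (k - r)"
        using tr by auto
      ultimately show ?thesis by (simp only: zbinom_int)
    qed
  qed
  moreover have "int n - int l + s + 1 = int n - int t" "int k - int l + s + 2 = int k - int t + 1" for n
    using t by auto
  ultimately show ?thesis by (intro exI[of _ n0]) (simp only:, blast)
qed

end
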